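(* Let $n\ge 3$ and let $F$ be a field. The set $$S_n=\{x_n^{2n-3}-x_n\}\cup\{x_kx_n^{2(n-2)}-x_k:\ 2\le k\le n-1\}\cup\{x_k^2-x_n^2:\ 2\le k\le n-1\}\cup\{x_1-x_2x_3\cdots x_n\}$$ is a Gröbner basis of the ideal $I_n\subset F[x_1,\dots,x_n]$ with respect to the lexicographic order with $x_1>x_2>\cdots>x_n$.
   Context: $I_n\subset F[x_1,\dots,x_n]$ is the ideal generated by the $n$ binomials $\prod_{j\ne i}x_j-x_i$, $1\le i\le n$. *)

theory Defs
  imports "HOL-Library.Poly_Mapping" "HOL-Algebra.Ideal"
begin

text \<open>
  A monomial is a finitely supported exponent function \<^typ>\<open>nat \<Rightarrow>\<^sub>0 nat\<close>, and a polynomial is a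
  finitely supported function from monomials to coefficients; multiplication is the convolution
  product of \<^theory>\<open>HOL-Library.Poly_Mapping\<close>. The type has the variables
  \<open>x\<^sub>0, x\<^sub>1, x\<^sub>2, \<dots>\<close>; the ring \<open>F[x\<^sub>1, \<dots>, x\<^sub>n]\<close> is cut out as a carrier set.
\<close>

type_synonym 'a mpoly = "(nat \<Rightarrow>\<^sub>0 nat) \<Rightarrow>\<^sub>0 'a"

definition mpoly_ring :: "nat \<Rightarrow> 'a::comm_ring_1 mpoly ring" where
  "mpoly_ring n =
     \<lparr>carrier = {p. \<forall>m\<in>Poly_Mapping.keys p. Poly_Mapping.keys m \<subseteq> {1..n}},
      monoid.mult = (*), one = 1, zero = 0, add = (+)\<rparr>"

lemma cring_mpoly_ring: "cring (mpoly_ring n :: 'a::comm_ring_1 mpoly ring)"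
proof (rule cringI)
  show "abelian_group (mpoly_ring n :: 'a mpoly ring)"
  proof (rule abelian_groupI)
    fix p assume "p \<in> carrier (mpoly_ring n :: 'a mpoly ring)"
    then show "\<exists>q\<in>carrier (mpoly_ring n). q \<oplus>\<^bsub>mpoly_ring n\<^esub> p = \<zero>\<^bsub>mpoly_ring n\<^esub>"
      by (intro bexI[of _ "- p"]) (auto simp: mpoly_ring_def)
  qed (auto simp: mpoly_ring_def algebra_simps dest!: subsetD[OF keys_add] split: if_splits)
  show "comm_monoid (mpoly_ring n :: 'a mpoly ring)"
    by unfold_locales
      (fastforce simp: mpoly_ring_def algebra_simps dest!: subsetD[OF keys_mult] subsetD[OF keys_add])+
qed (auto simp: mpoly_ring_def algebra_simps)

definition X :: "nat \<Rightarrow> 'a::comm_ring_1 mpoly" where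
  "X i = Poly_Mapping.single (Poly_Mapping.single i 1) 1"

text \<open>
  The library order on monomials compares exponents at the smallest index where they differ,
  so it is the lexicographic order with \<open>x\<^sub>1 > x\<^sub>2 > \<dots> > x\<^sub>n\<close>.
\<close>

lemma monom_less_iff_lex:
  fixes s t :: "nat \<Rightarrow>\<^sub>0 nat"
  shows "s < t \<longleftrightarrow> (\<exists>k. Poly_Mapping.lookup s k < Poly_Mapping.lookup t k \<and>
           (\<forall>j<k. Poly_Mapping.lookup s j = Poly_Mapping.lookup t j))"
  by (simp add: less_poly_mapping.rep_eq less_fun_def)

text \<open>Only meaningful for nonzero \<open>p\<close>.\<close>

definition lead_monom :: "'a::comm_ring_1 mpoly \<Rightarrow> (nat \<Rightarrow>\<^sub>0 nat)" where
  "lead_monom p = Max (Poly_Mapping.keys p)"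

definition lead_term :: "'a::comm_ring_1 mpoly \<Rightarrow> 'a mpoly" where
  "lead_term p = Poly_Mapping.single (lead_monom p) (Poly_Mapping.lookup p (lead_monom p))"

definition lead_terms :: "'a::comm_ring_1 mpoly set \<Rightarrow> 'a mpoly set" where
  "lead_terms A = lead_term ` (A - {0})"

definition lex_groebner_basis :: "nat \<Rightarrow> 'a::field mpoly set \<Rightarrow> 'a mpoly set \<Rightarrow> bool" where
  "lex_groebner_basis n G I \<longleftrightarrow>
     finite G \<and> G \<subseteq> I \<and>
     genideal (mpoly_ring n) (lead_terms G) = genideal (mpoly_ring n) (lead_terms I)"

definition I_ideal :: "nat \<Rightarrow> 'a::field mpoly set" where
  "I_ideal n = genideal (mpoly_ring n) {(\<Prod>j\<in>{1..n} - {i}. X j) - X i | i. i \<in> {1..n}}"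

definition S_set :: "nat \<Rightarrow> 'a::field mpoly set" where
  "S_set n =
     {X n ^ (2 * n - 3) - X n} \<union>
     {X k * X n ^ (2 * (n - 2)) - X k | k. k \<in> {2..n - 1}} \<union>
     {X k ^ 2 - X n ^ 2 | k. k \<in> {2..n - 1}} \<union>
     {X 1 - (\<Prod>j\<in>{2..n}. X j)}"

end

theory Submission
  imports Defs
begin

text \<open>
  Modulo \<open>I\<^sub>n\<close> every square \<open>x\<^sub>i\<^sup>2\<close> equals the product of all variables, since the \<open>i\<close>-th generator
  can be multiplied by \<open>x\<^sub>i\<close>. So all squares agree, \<open>x\<^sub>1\<close> is the product of the other variables, and
  eliminating \<open>x\<^sub>1\<close> from the remaining generators leaves \<open>x\<^sub>k x\<^sub>n\<^bsup>2(n-2)\<^esup> = x\<^sub>k\<close>, which for \<open>k = n\<close>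
  is \<open>x\<^sub>n\<^bsup>2n-3\<^esup> = x\<^sub>n\<close>. This places \<open>S\<^sub>n\<close> inside \<open>I\<^sub>n\<close> (\<open>S_set_subset_I_ideal\<close>).

  It remains to see that the leading monomial of every nonzero \<open>f \<in> I\<^sub>n\<close> is divisible by a leading
  monomial of \<open>S\<^sub>n\<close> (\<open>lead_monom_divisible\<close>). Because \<open>I\<^sub>n\<close> is generated by differences of two
  monomials, the quotient is the algebra of a commutative monoid, namely the monomials modulo a
  congruence. Apart from the class of the monomial \<open>1\<close>, which
  is a singleton, this monoid is the finite abelian group generated by \<open>x\<^sub>2, \<dots>, x\<^sub>n\<close> with
  \<open>x\<^sub>k\<^sup>2 = x\<^sub>n\<^sup>2\<close> and \<open>x\<^sub>n\<^bsup>2(n-2)\<^esup> = 1\<close>. Its elements are told apart by \<open>n - 2\<close> parities and a degree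
  modulo \<open>2(n-2)\<close>; \<open>same_class\<close> is written in terms of these invariants.

  Since the congruence respects multiplication and identifies the two monomials of every generator,
  the coefficients of any \<open>f \<in> I\<^sub>n\<close> sum to zero over each class (\<open>I_ideal_coeff_sum\<close>). On the other
  hand, a monomial divisible by no leading monomial of \<open>S\<^sub>n\<close> is the least one of its class
  (\<open>standard_monomial_least\<close>). If it were the leading monomial of \<open>f\<close>, it would be the only monomial
  of its class occurring in \<open>f\<close>, and its coefficient would have to vanish.
\<close>

section \<open>Polynomials in finitely many variables\<close>

lemma mpoly_ring_simps [simp]:
  "mult (mpoly_ring n) = (*)" "one (mpoly_ring n) = 1"
  "zero (mpoly_ring n) = 0" "add (mpoly_ring n) = (+)"
  by (simp_all add: mpoly_ring_def)

lemma mem_carrier_iff: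
  "p \<in> carrier (mpoly_ring n) \<longleftrightarrow>
     (\<forall>m\<in>Poly_Mapping.keys p. Poly_Mapping.keys m \<subseteq> {1..n})"
  by (simp add: mpoly_ring_def)

lemma ring_mpoly_ring: "ring (mpoly_ring n :: 'a::comm_ring_1 mpoly ring)"
  using cring_mpoly_ring cring.axioms(1) by blast

lemma uminus_closed: "p \<in> carrier (mpoly_ring n) \<Longrightarrow> - p \<in> carrier (mpoly_ring n)"
  by (simp add: mem_carrier_iff)

lemma a_inv_mpoly_ring:
  assumes "p \<in> carrier (mpoly_ring n :: 'a::comm_ring_1 mpoly ring)"
  shows "\<ominus>\<^bsub>mpoly_ring n\<^esub> p = - p"
proof -
  interpret ring "mpoly_ring n :: 'a mpoly ring" by (rule ring_mpoly_ring)
  show ?thesis using minus_equality[of "- p" p] assms uminus_closed[OF assms] by simp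
qed

lemma add_closed:
  assumes "p \<in> carrier (mpoly_ring n)" "q \<in> carrier (mpoly_ring n)"
  shows "p + q \<in> carrier (mpoly_ring n)"
  using ring.ring_simprules(1)[OF ring_mpoly_ring assms] by simp

lemma mult_closed:
  assumes "p \<in> carrier (mpoly_ring n)" "q \<in> carrier (mpoly_ring n)"
  shows "p * q \<in> carrier (mpoly_ring n)"
  using ring.ring_simprules(5)[OF ring_mpoly_ring assms] by simp

lemma diff_closed:
  assumes "p \<in> carrier (mpoly_ring n)" "q \<in> carrier (mpoly_ring n)"
  shows "p - q \<in> carrier (mpoly_ring n)"
  using add_closed[OF assms(1) uminus_closed[OF assms(2)]] by simp

lemma single_closed:
  "Poly_Mapping.keys m \<subseteq> {1..n} \<Longrightarrow> Poly_Mapping.single m c \<in> carrier (mpoly_ring n)"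
  by (simp add: mem_carrier_iff)

lemma X_closed: "i \<in> {1..n} \<Longrightarrow> X i \<in> carrier (mpoly_ring n)"
  unfolding X_def by (rule single_closed) simp

lemma one_closed: "1 \<in> carrier (mpoly_ring n)"
  by (auto simp: mem_carrier_iff)

lemma prod_closed:
  assumes "\<And>i. i \<in> A \<Longrightarrow> f i \<in> carrier (mpoly_ring n)"
  shows "prod f A \<in> carrier (mpoly_ring n)"
  using assms by (induction A rule: infinite_finite_induct) (auto intro: one_closed mult_closed)

lemma X_power: "X k ^ e = Poly_Mapping.single (Poly_Mapping.single k e) 1"
  by (induction e) (simp_all add: X_def mult_single flip: single_add)

lemma prod_X: "(\<Prod>j\<in>A. X j) = Poly_Mapping.single (\<Sum>j\<in>A. Poly_Mapping.single j 1) 1"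
  by (induction A rule: infinite_finite_induct) (simp_all add: X_def mult_single)

lemma lookup_sum_singles:
  assumes "finite A"
  shows "Poly_Mapping.lookup (\<Sum>j\<in>A. Poly_Mapping.single j (e::nat)) i = (if i \<in> A then e else 0)"
  using assms by (simp add: lookup_sum lookup_single when_def)

lemma monom_divides_iff:
  fixes s t :: "nat \<Rightarrow>\<^sub>0 nat"
  shows "(\<exists>u. t = u + s) \<longleftrightarrow> (\<forall>k. Poly_Mapping.lookup s k \<le> Poly_Mapping.lookup t k)"
proof
  assume "\<forall>k. Poly_Mapping.lookup s k \<le> Poly_Mapping.lookup t k"
  then have "t = (t - s) + s" by (intro poly_mapping_eqI) (simp add: lookup_add lookup_minus)
  then show "\<exists>u. t = u + s" by blast
qed (auto simp: lookup_add)

section \<open>Congruence modulo an ideal\<close>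

definition ideal_cong :: "nat \<Rightarrow> 'a::comm_ring_1 mpoly set \<Rightarrow> 'a mpoly \<Rightarrow> 'a mpoly \<Rightarrow> bool" where
  "ideal_cong n J p q \<longleftrightarrow>
     p \<in> carrier (mpoly_ring n) \<and> q \<in> carrier (mpoly_ring n) \<and> p - q \<in> J"

context
  fixes n :: nat and J :: "'a::comm_ring_1 mpoly set"
  assumes J: "ideal J (mpoly_ring n)"
begin

interpretation ideal J "mpoly_ring n" by (rule J)

lemma ideal_cong_refl: "p \<in> carrier (mpoly_ring n) \<Longrightarrow> ideal_cong n J p p"
  using additive_subgroup.zero_closed[OF is_additive_subgroup] by (simp add: ideal_cong_def)

lemma ideal_cong_sym: "ideal_cong n J p q \<Longrightarrow> ideal_cong n J q p"
  unfolding ideal_cong_def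
  using additive_subgroup.a_inv_closed[OF is_additive_subgroup, of "p - q"]
    a_inv_mpoly_ring[of "p - q" n] diff_closed[of p n q] by auto

lemma ideal_cong_trans: "ideal_cong n J p q \<Longrightarrow> ideal_cong n J q r \<Longrightarrow> ideal_cong n J p r"
  unfolding ideal_cong_def
  using additive_subgroup.a_closed[OF is_additive_subgroup, of "p - q" "q - r"] by auto

lemma ideal_cong_mult:
  assumes "ideal_cong n J p q" "ideal_cong n J p' q'"
  shows "ideal_cong n J (p * p') (q * q')"
proof -
  have "p' * (p - q) + q * (p' - q') \<in> J"
    using assms I_l_closed[of "p - q" p'] I_l_closed[of "p' - q'" q]
      additive_subgroup.a_closed[OF is_additive_subgroup, of "p' * (p - q)" "q * (p' - q')"]
    by (simp add: ideal_cong_def)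
  then show ?thesis using assms by (simp add: ideal_cong_def mult_closed algebra_simps)
qed

lemma ideal_cong_prod:
  assumes "\<And>i. i \<in> A \<Longrightarrow> ideal_cong n J (f i) (g i)"
  shows "ideal_cong n J (prod f A) (prod g A)"
  using assms
  by (induction A rule: infinite_finite_induct)
     (use one_closed in \<open>auto intro: ideal_cong_refl ideal_cong_mult\<close>)

end

section \<open>The basis lies in the ideal\<close>

lemma generators_closed:
  "{(\<Prod>j\<in>{1..n} - {i}. X j) - X i | i. i \<in> {1..n}} \<subseteq> carrier (mpoly_ring n)"
  by (auto intro!: diff_closed prod_closed X_closed)

lemma ideal_I_ideal: "ideal (I_ideal n) (mpoly_ring n)"
  unfolding I_ideal_def by (rule ring.genideal_ideal[OF ring_mpoly_ring generators_closed])

lemma generator_cong: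
  assumes "i \<in> {1..n}"
  shows "ideal_cong n (I_ideal n) (\<Prod>j\<in>{1..n} - {i}. X j) (X i)"
  using assms ring.genideal_self[OF ring_mpoly_ring generators_closed, of n]
  by (auto simp: ideal_cong_def I_ideal_def intro!: prod_closed X_closed)

text \<open>
  Multiplying the \<open>i\<close>-th generator by \<open>x\<^sub>i\<close> shows that \<open>x\<^sub>i\<^sup>2\<close> is congruent to the product of all
  variables, which does not depend on \<open>i\<close>.
\<close>

lemma square_cong:
  assumes "i \<in> {1..n}" "k \<in> {1..n}"
  shows "ideal_cong n (I_ideal n) (X i ^ 2) (X k ^ 2)"
proof -
  have "ideal_cong n (I_ideal n) (\<Prod>j\<in>{1..n}. X j) (X i ^ 2)" if "i \<in> {1..n}" for i
    using ideal_cong_mult[OF ideal_I_ideal ideal_cong_refl[OF ideal_I_ideal X_closed[OF that]]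
        generator_cong[OF that]] that
    by (simp add: power2_eq_square prod.remove)
  then show ?thesis
    using assms ideal_cong_trans[OF ideal_I_ideal] ideal_cong_sym[OF ideal_I_ideal] by blast
qed

lemma first_variable_cong:
  assumes "n \<ge> 1"
  shows "ideal_cong n (I_ideal n) (X 1) (\<Prod>j\<in>{2..n}. X j)"
proof -
  have "{1..n} - {1} = {2..n}" by auto
  then show ?thesis
    using generator_cong[of 1 n] assms ideal_cong_sym[OF ideal_I_ideal] by fastforce
qed

text \<open>
  In the \<open>k\<close>-th generator, replace \<open>x\<^sub>1\<close> by \<open>x\<^sub>2 \<cdots> x\<^sub>n\<close>: the product of the variables other than \<open>x\<^sub>k\<close>
  becomes \<open>x\<^sub>k\<close> times \<open>n - 2\<close> squares, each congruent to \<open>x\<^sub>n\<^sup>2\<close>. The case \<open>k = n\<close> gives the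
  univariate basis element.
\<close>

lemma high_power_cong:
  assumes "k \<in> {2..n}"
  shows "ideal_cong n (I_ideal n) (X k * X n ^ (2 * (n - 2))) (X k)"
proof -
  note I = ideal_I_ideal[of n]
  define B where "B = {2..n} - {k}"
  have B: "finite B" "card B = n - 2" "{1..n} - {k} = insert 1 B" "1 \<notin> B" "{2..n} = insert k B" "k \<notin> B"
    using assms by (auto simp: B_def)
  have Bsub: "j \<in> {1..n}" if "j \<in> B" for j using that by (auto simp: B_def)
  have "ideal_cong n (I_ideal n) (\<Prod>j\<in>B. X j ^ 2) (\<Prod>j\<in>B. X n ^ 2)"
    using assms Bsub by (intro ideal_cong_prod[OF I] square_cong) auto
  then have sq: "ideal_cong n (I_ideal n) (\<Prod>j\<in>B. X j ^ 2) (X n ^ (2 * (n - 2)))"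
    using B by (simp add: power_mult)
  have "ideal_cong n (I_ideal n) (X 1 * (\<Prod>j\<in>B. X j)) ((\<Prod>j\<in>{2..n}. X j) * (\<Prod>j\<in>B. X j))"
    using assms Bsub
    by (intro ideal_cong_mult[OF I] ideal_cong_refl[OF I] first_variable_cong prod_closed X_closed) auto
  also have "X 1 * (\<Prod>j\<in>B. X j) = (\<Prod>j\<in>{1..n} - {k}. X j)"
    using B by simp
  also have "(\<Prod>j\<in>{2..n}. X j) * (\<Prod>j\<in>B. X j) = X k * (\<Prod>j\<in>B. X j ^ 2)"
    using B by (simp add: power2_eq_square prod.distrib mult.assoc)
  finally have "ideal_cong n (I_ideal n) (X k) (X k * (\<Prod>j\<in>B. X j ^ 2))"
    using generator_cong[of k n] assms ideal_cong_trans[OF I] ideal_cong_sym[OF I] by fastforce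
  moreover have "ideal_cong n (I_ideal n) (X k * (\<Prod>j\<in>B. X j ^ 2)) (X k * X n ^ (2 * (n - 2)))"
    using assms by (intro ideal_cong_mult[OF I] sq ideal_cong_refl[OF I] X_closed) auto
  ultimately show ?thesis using ideal_cong_trans[OF I] ideal_cong_sym[OF I] by blast
qed

lemma S_set_subset_I_ideal:
  assumes "n \<ge> 3"
  shows "S_set n \<subseteq> (I_ideal n :: 'a::field mpoly set)"
proof -
  have "2 * n - 3 = Suc (2 * (n - 2))" using assms by simp
  then have "X n ^ (2 * n - 3) - X n \<in> (I_ideal n :: 'a mpoly set)"
    using high_power_cong[of n n, where 'a = 'a] assms by (simp add: ideal_cong_def)
  then show ?thesis
    using high_power_cong[of _ n, where 'a = 'a] square_cong[of _ n n, where 'a = 'a]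
      first_variable_cong[of n, where 'a = 'a] assms
    by (fastforce simp: S_set_def ideal_cong_def)
qed

section \<open>Leading terms of the basis\<close>

lemma lead_monom_in_keys: "p \<noteq> 0 \<Longrightarrow> lead_monom p \<in> Poly_Mapping.keys p"
  unfolding lead_monom_def by (intro Max_in) auto

lemma keys_lead_monom:
  assumes "p \<in> carrier (mpoly_ring n)" "p \<noteq> 0"
  shows "Poly_Mapping.keys (lead_monom p) \<subseteq> {1..n}"
  using assms lead_monom_in_keys unfolding mem_carrier_iff by blast

lemma lead_terms_closed:
  assumes "A \<subseteq> carrier (mpoly_ring n)"
  shows "lead_terms A \<subseteq> carrier (mpoly_ring n)"
  using assms keys_lead_monom unfolding lead_terms_def lead_term_def
  by (fastforce intro!: single_closed)

lemma lead_term_binomial: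
  fixes s t :: "nat \<Rightarrow>\<^sub>0 nat"
  assumes "t < s"
  defines "p \<equiv> Poly_Mapping.single s 1 - Poly_Mapping.single t (1 :: 'a::comm_ring_1)"
  shows "p \<noteq> 0" "lead_term p = Poly_Mapping.single s 1"
proof -
  have s: "Poly_Mapping.lookup p s = 1"
    using assms by (simp add: p_def lookup_minus lookup_single when_def)
  then show "p \<noteq> 0" by auto
  have "Poly_Mapping.keys p \<subseteq> {s, t}"
    unfolding p_def using keys_diff by fastforce
  moreover have "s \<in> Poly_Mapping.keys p"
    using s by (simp add: in_keys_iff)
  ultimately have "Max (Poly_Mapping.keys p) = s"
    using assms(1) by (intro Max_eqI) auto
  then show "lead_term p = Poly_Mapping.single s 1"
    by (simp add: lead_term_def lead_monom_def s)
qed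

lemma single_mem_lead_terms:
  assumes "Poly_Mapping.single s 1 - Poly_Mapping.single t 1 \<in> A" "t < s"
  shows "Poly_Mapping.single s 1 \<in> lead_terms A"
  unfolding lead_terms_def using lead_term_binomial[OF assms(2)] assms(1) by (metis DiffI image_eqI singletonD)

lemma lead_terms_S_set:
  assumes "n \<ge> 3"
  shows "Poly_Mapping.single (Poly_Mapping.single n (2 * n - 3)) 1 \<in> lead_terms (S_set n)"
    and "k \<in> {2..n - 1} \<Longrightarrow>
      Poly_Mapping.single (Poly_Mapping.single k 1 + Poly_Mapping.single n (2 * (n - 2))) 1
        \<in> lead_terms (S_set n)"
    and "k \<in> {2..n - 1} \<Longrightarrow>
      Poly_Mapping.single (Poly_Mapping.single k 2) 1 \<in> lead_terms (S_set n)"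
    and "Poly_Mapping.single (Poly_Mapping.single 1 1) 1 \<in> lead_terms (S_set n)"
proof -
  have "X n ^ (2 * n - 3) - X n \<in> S_set n" by (auto simp: S_set_def)
  moreover have "Poly_Mapping.single n 1 < Poly_Mapping.single n (2 * n - 3)"
    using assms unfolding monom_less_iff_lex by (intro exI[of _ n]) (auto simp: lookup_single when_def)
  ultimately show "Poly_Mapping.single (Poly_Mapping.single n (2 * n - 3)) 1 \<in> lead_terms (S_set n)"
    unfolding X_power by (intro single_mem_lead_terms) (simp_all add: X_def)
  have "X 1 - (\<Prod>j\<in>{2..n}. X j) \<in> S_set n" by (auto simp: S_set_def)
  moreover have "(\<Sum>j\<in>{2..n}. Poly_Mapping.single j 1) < Poly_Mapping.single 1 (1::nat)"
    unfolding monom_less_iff_lex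
    by (intro exI[of _ 1]) (auto simp: lookup_sum_singles lookup_single when_def)
  ultimately show "Poly_Mapping.single (Poly_Mapping.single 1 1) 1 \<in> lead_terms (S_set n)"
    unfolding prod_X by (intro single_mem_lead_terms) (simp_all add: X_def)
  assume k: "k \<in> {2..n - 1}"
  then have "X k ^ 2 - X n ^ 2 \<in> S_set n" by (auto simp: S_set_def)
  moreover have "Poly_Mapping.single n 2 < Poly_Mapping.single k (2::nat)"
    using k unfolding monom_less_iff_lex by (intro exI[of _ k]) (auto simp: lookup_single when_def)
  ultimately show "Poly_Mapping.single (Poly_Mapping.single k 2) 1 \<in> lead_terms (S_set n)"
    by (intro single_mem_lead_terms) (simp_all add: X_power)
  have "X k * X n ^ (2 * (n - 2)) - X k \<in> S_set n" using k by (auto simp: S_set_def)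
  moreover have "Poly_Mapping.single k 1 < Poly_Mapping.single k 1 + Poly_Mapping.single n (2 * (n - 2))"
    using assms k unfolding monom_less_iff_lex
    by (intro exI[of _ n]) (auto simp: lookup_add lookup_single when_def)
  ultimately show "Poly_Mapping.single (Poly_Mapping.single k 1 + Poly_Mapping.single n (2 * (n - 2))) 1
      \<in> lead_terms (S_set n)"
    unfolding X_power by (intro single_mem_lead_terms) (simp_all add: X_def mult_single)
qed

section \<open>Weighted coefficient sums\<close>

text \<open>
  A sum of coefficients over one congruence class is the case where \<open>g\<close> is the indicator of the
  class. Allowing every \<open>g\<close> that is constant on the classes makes the vanishing condition stable
  under multiplication by a monomial \<open>u\<close>, which merely replaces \<open>g\<close> by its translate \<open>m \<mapsto> g (u + m)\<close>.
\<close>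

definition coeff_sum :: "((nat \<Rightarrow>\<^sub>0 nat) \<Rightarrow> 'a::comm_ring_1) \<Rightarrow> 'a mpoly \<Rightarrow> 'a" where
  "coeff_sum g p = (\<Sum>m\<in>Poly_Mapping.keys p. Poly_Mapping.lookup p m * g m)"

lemma coeff_sum_superset:
  assumes "finite A" "Poly_Mapping.keys p \<subseteq> A"
  shows "coeff_sum g p = (\<Sum>m\<in>A. Poly_Mapping.lookup p m * g m)"
  unfolding coeff_sum_def using assms by (intro sum.mono_neutral_left) (auto simp: in_keys_iff)

lemma coeff_sum_zero [simp]: "coeff_sum g 0 = 0"
  by (simp add: coeff_sum_def)

lemma coeff_sum_add: "coeff_sum g (p + q) = coeff_sum g p + coeff_sum g q"
proof -
  let ?A = "Poly_Mapping.keys p \<union> Poly_Mapping.keys q"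
  have "finite ?A" "Poly_Mapping.keys (p + q) \<subseteq> ?A" by (auto simp: keys_add)
  then show ?thesis
    by (simp add: coeff_sum_superset[of ?A] lookup_add distrib_right sum.distrib)
qed

lemma coeff_sum_uminus: "coeff_sum g (- p) = - coeff_sum g p"
  by (simp add: coeff_sum_def sum_negf)

lemma coeff_sum_single: "coeff_sum g (Poly_Mapping.single m c) = c * g m"
  by (simp add: coeff_sum_superset[of "{m}"])

lemma coeff_sum_diff: "coeff_sum g (p - q) = coeff_sum g p - coeff_sum g q"
  using coeff_sum_add[of g p "- q"] by (simp add: coeff_sum_uminus)

lemma mpoly_induct [case_names single add]:
  assumes "\<And>m c. P (Poly_Mapping.single m c)" "\<And>p q. P p \<Longrightarrow> P q \<Longrightarrow> P (p + q)"
  shows "P (p :: 'a::comm_ring_1 mpoly)"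
proof (induction p rule: update_induct)
  case const
  show ?case using assms(1)[of 0 0] by simp
next
  case (update p m c)
  then have "Poly_Mapping.update m c p = p + Poly_Mapping.single m c"
    by (intro poly_mapping_eqI) (auto simp: lookup_update lookup_add lookup_single in_keys_iff when_def)
  then show ?case using assms update by simp
qed

lemma coeff_sum_single_mult:
  "coeff_sum g (Poly_Mapping.single u c * p) = c * coeff_sum (\<lambda>m. g (u + m)) p"
  by (induction p rule: mpoly_induct)
     (simp_all add: mult_single coeff_sum_single coeff_sum_add distrib_left mult.assoc)

text \<open>
  Translates of a function constant on the classes of \<open>R\<close> are again constant on them, so the
  polynomials annihilated by all such functions absorb multiplication by monomials and therefore,
  by linearity, by all polynomials.
\<close>

lemma ideal_vanishing_coeff_sums:
  fixes R :: "(nat \<Rightarrow>\<^sub>0 nat) \<Rightarrow> (nat \<Rightarrow>\<^sub>0 nat) \<Rightarrow> bool"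
  assumes R: "\<And>s t u. R s t \<Longrightarrow> R (u + s) (u + t)"
  shows "ideal {p \<in> carrier (mpoly_ring n).
            \<forall>g :: _ \<Rightarrow> 'a::comm_ring_1. (\<forall>s t. R s t \<longrightarrow> g s = g t) \<longrightarrow> coeff_sum g p = 0}
          (mpoly_ring n)" (is "ideal ?J _")
proof -
  interpret ring "mpoly_ring n :: 'a mpoly ring" by (rule ring_mpoly_ring)
  have mult: "q * p \<in> ?J" if p: "p \<in> ?J" and q: "q \<in> carrier (mpoly_ring n)" for p q
  proof -
    have "coeff_sum g (q * p) = 0" if "\<forall>s t. R s t \<longrightarrow> g s = g t" for g :: "_ \<Rightarrow> 'a"
    proof (induction q rule: mpoly_induct)
      case (single u c)
      have "\<forall>s t. R s t \<longrightarrow> g (u + s) = g (u + t)" using that R by blast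
      then show ?case using p by (simp add: coeff_sum_single_mult)
    qed (simp add: distrib_right coeff_sum_add)
    then show ?thesis using p q mult_closed by auto
  qed
  show ?thesis
  proof (rule idealI)
    show "subgroup ?J (add_monoid (mpoly_ring n))"
    proof (rule add.subgroupI)
      have "(0 :: 'a mpoly) \<in> ?J" by (simp add: mem_carrier_iff)
      then show "?J \<noteq> {}" by blast
    qed (auto simp: a_inv_mpoly_ring coeff_sum_uminus coeff_sum_add
         intro: uminus_closed add_closed)
  qed (use mult ring_mpoly_ring in \<open>auto simp: mult.commute\<close>)
qed

section \<open>The congruence on monomials\<close>

text \<open>
  The degree for which \<open>x\<^sub>1\<close> counts as much as \<open>x\<^sub>2 \<cdots> x\<^sub>n\<close>.
\<close>

definition weight :: "nat \<Rightarrow> (nat \<Rightarrow>\<^sub>0 nat) \<Rightarrow> nat" where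
  "weight n s = (n - 1) * Poly_Mapping.lookup s 1 + (\<Sum>k\<in>{2..n}. Poly_Mapping.lookup s k)"

text \<open>
  All conditions survive the substitution \<open>x\<^sub>1 = x\<^sub>2 \<cdots> x\<^sub>n\<close>, after which the exponent of \<open>x\<^sub>k\<close> is
  that of \<open>x\<^sub>k\<close> plus that of \<open>x\<^sub>1\<close>: its parity for \<open>1 < k < n\<close> is unchanged by \<open>x\<^sub>k\<^sup>2 = x\<^sub>n\<^sup>2\<close>, and the
  total degree modulo \<open>2(n-2)\<close> by \<open>x\<^sub>k x\<^sub>n\<^bsup>2(n-2)\<^esup> = x\<^sub>k\<close>. The first condition separates \<open>1\<close> from
  \<open>x\<^sub>n\<^bsup>2(n-2)\<^esup>\<close>, which agree in the other invariants but not modulo \<open>I\<^sub>n\<close>.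
\<close>

definition same_class :: "nat \<Rightarrow> (nat \<Rightarrow>\<^sub>0 nat) \<Rightarrow> (nat \<Rightarrow>\<^sub>0 nat) \<Rightarrow> bool" where
  "same_class n s t \<longleftrightarrow>
     (s = 0 \<longleftrightarrow> t = 0) \<and>
     (\<forall>k\<in>{2..n - 1}. even (Poly_Mapping.lookup s 1 + Poly_Mapping.lookup s k) \<longleftrightarrow>
        even (Poly_Mapping.lookup t 1 + Poly_Mapping.lookup t k)) \<and>
     weight n s mod (2 * (n - 2)) = weight n t mod (2 * (n - 2))"

lemma weight_add: "weight n (s + t) = weight n s + weight n t"
  by (simp add: weight_def lookup_add sum.distrib distrib_left)

lemma monom_add_eq_0_iff:
  fixes s t :: "nat \<Rightarrow>\<^sub>0 nat"
  shows "s + t = 0 \<longleftrightarrow> s = 0 \<and> t = 0"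
  by (auto simp: poly_mapping_eq_iff fun_eq_iff lookup_add)

lemma same_class_refl: "same_class n s s"
  by (simp add: same_class_def)

lemma same_class_sym: "same_class n s t \<Longrightarrow> same_class n t s"
  by (auto simp: same_class_def)

lemma same_class_trans: "same_class n s t \<Longrightarrow> same_class n t u \<Longrightarrow> same_class n s u"
  by (auto simp: same_class_def)

lemma same_class_add:
  assumes "same_class n s t"
  shows "same_class n (u + s) (u + t)"
proof -
  have "weight n (u + s) mod (2 * (n - 2)) = weight n (u + t) mod (2 * (n - 2))"
    using assms by (auto simp: weight_add same_class_def intro: mod_add_cong)
  then show ?thesis
    using assms by (auto simp: same_class_def monom_add_eq_0_iff lookup_add)
qed

text \<open>
  For \<open>i > 1\<close> the product of the variables other than \<open>x\<^sub>i\<close> has weight \<open>(n-1) + (n-2) = 2(n-2) + 1\<close>;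
  this is what fixes the modulus.
\<close>

lemma same_class_generator:
  assumes "n \<ge> 3" "i \<in> {1..n}"
  shows "same_class n (\<Sum>j\<in>{1..n} - {i}. Poly_Mapping.single j 1) (Poly_Mapping.single i 1)"
proof -
  define s where "s = (\<Sum>j\<in>{1..n} - {i}. Poly_Mapping.single j (1::nat))"
  define t where "t = Poly_Mapping.single i (1::nat)"
  have ls: "Poly_Mapping.lookup s k = (if k \<in> {1..n} - {i} then 1 else 0)" for k
    unfolding s_def by (rule lookup_sum_singles) simp
  have lt: "Poly_Mapping.lookup t k = (if k = i then 1 else 0)" for k
    by (simp add: t_def lookup_single when_def)
  have "t \<noteq> 0" using lt[of i] by (metis lookup_zero zero_neq_one)
  moreover have "s \<noteq> 0"
  proof
    assume "s = 0"
    then have "k \<notin> {1..n} - {i}" for k using ls[of k] by (metis lookup_zero zero_neq_one)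
    from this[of 1] this[of 2] show False using assms by auto
  qed
  moreover have "weight n s mod (2 * (n - 2)) = weight n t mod (2 * (n - 2))"
  proof (cases "i = 1")
    case True
    have "(\<Sum>k\<in>{2..n}. Poly_Mapping.lookup s k) = (\<Sum>k\<in>{2..n}. 1)"
      using True by (intro sum.cong) (auto simp: ls)
    moreover have "(\<Sum>k\<in>{2..n}. Poly_Mapping.lookup t k) = 0"
      using True by (intro sum.neutral) (auto simp: lt)
    ultimately have "weight n s = weight n t"
      unfolding weight_def ls[of 1] lt[of 1] using True by simp
    then show ?thesis by simp
  next
    case False
    then have i: "i \<in> {2..n}" using assms by auto
    have "(\<Sum>k\<in>{2..n}. Poly_Mapping.lookup s k) = (\<Sum>k\<in>{2..n} - {i}. 1)"
      using i by (subst sum.remove[of _ i]) (auto simp: ls intro!: sum.cong)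
    then have 1: "weight n s = 2 * (n - 2) + 1"
      unfolding weight_def ls[of 1] using i False assms by simp
    have "(\<Sum>k\<in>{2..n}. Poly_Mapping.lookup t k) = 1"
      using i by (simp add: lt)
    then have "weight n t = 1"
      unfolding weight_def lt[of 1] using False by simp
    then show ?thesis by (simp only: 1 mod_add_self1)
  qed
  ultimately show ?thesis
    unfolding s_def[symmetric] t_def[symmetric] same_class_def ls lt using assms by auto
qed

lemma I_ideal_coeff_sum:
  fixes p :: "'a::field mpoly"
  assumes "n \<ge> 3" "p \<in> I_ideal n" "\<And>s t. same_class n s t \<Longrightarrow> g s = g t"
  shows "coeff_sum g p = 0"
proof -
  let ?J = "{p \<in> carrier (mpoly_ring n).
            \<forall>g :: _ \<Rightarrow> 'a. (\<forall>s t. same_class n s t \<longrightarrow> g s = g t) \<longrightarrow> coeff_sum g p = 0}"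
  have "coeff_sum g ((\<Prod>j\<in>{1..n} - {i}. X j) - X i) = 0"
    if "i \<in> {1..n}" "\<forall>s t. same_class n s t \<longrightarrow> g s = g t" for i and g :: "_ \<Rightarrow> 'a"
    unfolding prod_X coeff_sum_diff
    using same_class_generator[OF assms(1) that(1)] that(2) by (simp add: X_def coeff_sum_single)
  then have "{(\<Prod>j\<in>{1..n} - {i}. X j) - X i | i. i \<in> {1..n}} \<subseteq> ?J"
    using generators_closed[of n] by blast
  then have "I_ideal n \<subseteq> ?J"
    unfolding I_ideal_def
    by (intro ring.genideal_minimal[OF ring_mpoly_ring] ideal_vanishing_coeff_sums same_class_add)
  then show ?thesis using assms by auto
qed

section \<open>Leading monomials of the ideal\<close>

text \<open>
  At the first exponent where a smaller monomial \<open>s\<close> of the same class differs from \<open>t\<close>, it has to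
  be smaller. If this happens at \<open>x\<^sub>k\<close> with \<open>1 < k < n\<close>, an exponent \<open>1\<close> drops to \<open>0\<close> and the parity
  changes. If it happens at \<open>x\<^sub>n\<close>, the exponents there differ by a positive multiple of \<open>2(n-2)\<close>,
  which forces \<open>t = x\<^sub>n\<^bsup>2(n-2)\<^esup>\<close> and \<open>s = 1\<close>; these are in different classes.
\<close>

lemma standard_monomial_least:
  assumes n: "n \<ge> 3"
    and keys: "Poly_Mapping.keys s \<subseteq> {1..n}" "Poly_Mapping.keys t \<subseteq> {1..n}"
    and first: "Poly_Mapping.lookup t 1 = 0"
    and middle: "\<And>k. k \<in> {2..n - 1} \<Longrightarrow> Poly_Mapping.lookup t k \<le> 1"
    and last: "Poly_Mapping.lookup t n \<le> 2 * (n - 2)"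
    and mixed: "\<And>k. k \<in> {2..n - 1} \<Longrightarrow> Poly_Mapping.lookup t n = 2 * (n - 2) \<Longrightarrow>
                  Poly_Mapping.lookup t k = 0"
    and st: "same_class n s t"
  shows "t \<le> s"
proof (rule ccontr)
  assume "\<not> t \<le> s"
  then have "s < t" by simp
  then obtain k where k: "Poly_Mapping.lookup s k < Poly_Mapping.lookup t k"
    and below: "\<And>j. j < k \<Longrightarrow> Poly_Mapping.lookup s j = Poly_Mapping.lookup t j"
    unfolding monom_less_iff_lex by blast
  have "k \<in> Poly_Mapping.keys t" using k by (simp add: in_keys_iff)
  with keys first k have "k \<in> {2..n}"
    by (metis atLeastAtMost_iff subsetD not_less_zero le_neq_implies_less Suc_leI Suc_1 One_nat_def)
  then consider "k \<in> {2..n - 1}" | "k = n" by (cases "k = n") auto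
  then show False
  proof cases
    case 1
    then have "Poly_Mapping.lookup s k = 0" "Poly_Mapping.lookup t k = 1"
      using k middle[of k] by auto
    moreover have "Poly_Mapping.lookup s 1 = 0" using below[of 1] first 1 by simp
    moreover have "even (Poly_Mapping.lookup s 1 + Poly_Mapping.lookup s k) \<longleftrightarrow>
        even (Poly_Mapping.lookup t 1 + Poly_Mapping.lookup t k)"
      using st 1 unfolding same_class_def by blast
    ultimately show False using first by simp
  next
    case 2
    let ?a = "\<Sum>k\<in>{2..n - 1}. Poly_Mapping.lookup t k"
    have n2: "{2..n} = insert n {2..n - 1}" using n by auto
    have s1: "Poly_Mapping.lookup s 1 = 0" using below[of 1] first 2 n by simp
    have "(\<Sum>k\<in>{2..n - 1}. Poly_Mapping.lookup s k) = ?a"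
      using 2 n by (intro sum.cong) (auto intro!: below)
    then have ws: "weight n s = ?a + Poly_Mapping.lookup s n"
      unfolding weight_def s1 n2 using n by simp
    have wt: "weight n t = ?a + Poly_Mapping.lookup t n"
      unfolding weight_def first n2 using n by simp
    have "2 * (n - 2) dvd weight n t - weight n s"
      using st k 2 by (intro mod_eq_dvd_iff_nat[THEN iffD1]) (simp_all add: same_class_def ws wt)
    then have "2 * (n - 2) \<le> Poly_Mapping.lookup t n - Poly_Mapping.lookup s n"
      using k 2 by (intro dvd_imp_le) (auto simp: ws wt)
    then have tn: "Poly_Mapping.lookup t n = 2 * (n - 2)" and sn: "Poly_Mapping.lookup s n = 0"
      using last k 2 n by linarith+
    have "Poly_Mapping.lookup s j = 0" for j
    proof (cases "j \<in> {1..n}")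
      case True
      then consider "j = 1" | "j \<in> {2..n - 1}" | "j = n" by (cases "j = 1"; cases "j = n") auto
      then show ?thesis
        using s1 sn mixed[of j] tn below[of j] 2 n by cases auto
    next
      case False
      then show ?thesis using keys(1) by (meson in_keys_iff subsetD)
    qed
    then have "s = 0" by (intro poly_mapping_eqI) simp
    moreover have "t \<noteq> 0" using tn n by auto
    ultimately show False using st by (simp add: same_class_def)
  qed
qed

text \<open>
  Otherwise the leading monomial is both the largest monomial of \<open>f\<close> and the smallest of its class,
  so its coefficient is the whole coefficient sum of the class, which is zero.
\<close>

lemma lead_monom_divisible:
  fixes f :: "'a::field mpoly"
  assumes n: "n \<ge> 3" and f: "f \<in> I_ideal n" "f \<noteq> 0"
  shows "\<exists>s u. Poly_Mapping.single s 1 \<in> lead_terms (S_set n :: 'a mpoly set) \<and> lead_monom f = u + s"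
proof (rule ccontr)
  assume none: "\<not> ?thesis"
  define t where "t = lead_monom f"
  have t: "t \<in> Poly_Mapping.keys f"
    unfolding t_def using f(2) by (rule lead_monom_in_keys)
  have carrier: "f \<in> carrier (mpoly_ring n)"
    using ideal.Icarr[OF ideal_I_ideal] f by blast
  have not_div: "\<not> (\<forall>k. Poly_Mapping.lookup s k \<le> Poly_Mapping.lookup t k)"
    if "Poly_Mapping.single s 1 \<in> lead_terms (S_set n :: 'a mpoly set)" for s
    using none that unfolding t_def monom_divides_iff[symmetric] by blast
  have single_div: "Poly_Mapping.lookup t k < e"
    if "Poly_Mapping.single (Poly_Mapping.single k e) 1 \<in> lead_terms (S_set n :: 'a mpoly set)" for k e
    using not_div[OF that] by (auto simp: lookup_single when_def split: if_splits)
  have least: "t \<le> s" if "s \<in> Poly_Mapping.keys f" "same_class n s t" for s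
  proof (rule standard_monomial_least[OF n])
    show "Poly_Mapping.lookup t 1 = 0"
      using single_div[OF lead_terms_S_set(4)[OF n]] by simp
    show "Poly_Mapping.lookup t k \<le> 1" if "k \<in> {2..n - 1}" for k
      using single_div[OF lead_terms_S_set(3)[OF n that]] by simp
    show "Poly_Mapping.lookup t n \<le> 2 * (n - 2)"
      using single_div[OF lead_terms_S_set(1)[OF n]] n by simp
    show "Poly_Mapping.lookup t k = 0"
      if "k \<in> {2..n - 1}" "Poly_Mapping.lookup t n = 2 * (n - 2)" for k
      using not_div[OF lead_terms_S_set(2)[OF n that(1)]] that
      by (auto simp: lookup_add lookup_single when_def split: if_splits)
  qed (use that t carrier in \<open>auto simp: mem_carrier_iff\<close>)
  have eq: "s = t" if "s \<in> Poly_Mapping.keys f" "same_class n s t" for s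
    using least[OF that] that(1) by (simp add: t_def lead_monom_def antisym)
  let ?g = "\<lambda>s. if same_class n s t then 1 else (0::'a)"
  have "coeff_sum ?g f = (\<Sum>m\<in>Poly_Mapping.keys f. if m = t then Poly_Mapping.lookup f t else 0)"
    unfolding coeff_sum_def using eq by (intro sum.cong) (auto simp: same_class_refl)
  also have "\<dots> = Poly_Mapping.lookup f t" using t by simp
  finally have "coeff_sum ?g f \<noteq> 0" using t by (simp add: in_keys_iff)
  moreover have "coeff_sum ?g f = 0"
    by (rule I_ideal_coeff_sum[OF n f(1)]) (meson same_class_sym same_class_trans)
  ultimately show False by contradiction
qed

lemma finite_S_set: "finite (S_set n)"
  by (simp add: S_set_def)

theorem proposition1p3:
  fixes n :: nat
  assumes "n \<ge> 3"
  shows "lex_groebner_basis n (S_set n :: 'a::field mpoly set) (I_ideal n)"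
proof -
  interpret ring "mpoly_ring n :: 'a mpoly ring" by (rule ring_mpoly_ring)
  let ?S = "S_set n :: 'a mpoly set" and ?I = "I_ideal n :: 'a mpoly set"
  have SI: "?S \<subseteq> ?I" using S_set_subset_I_ideal[OF assms] .
  have Ic: "?I \<subseteq> carrier (mpoly_ring n)" using ideal.Icarr[OF ideal_I_ideal] by blast
  have ltI: "lead_terms ?I \<subseteq> carrier (mpoly_ring n)" by (rule lead_terms_closed[OF Ic])
  have ltS: "lead_terms ?S \<subseteq> carrier (mpoly_ring n)" by (rule lead_terms_closed) (use SI Ic in blast)
  interpret LS: ideal "genideal (mpoly_ring n) (lead_terms ?S)" "mpoly_ring n"
    by (rule genideal_ideal[OF ltS])
  have "lead_terms ?I \<subseteq> genideal (mpoly_ring n) (lead_terms ?S)"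
  proof
    fix q assume q: "q \<in> lead_terms ?I"
    then obtain f where f: "f \<in> ?I" "f \<noteq> 0" "q = lead_term f" by (auto simp: lead_terms_def)
    then obtain s u where s: "Poly_Mapping.single s 1 \<in> lead_terms ?S" and u: "lead_monom f = u + s"
      using lead_monom_divisible[OF assms] by blast
    define c where "c = Poly_Mapping.lookup f (lead_monom f)"
    have q_eq: "q = Poly_Mapping.single u c * Poly_Mapping.single s 1"
      by (simp add: f lead_term_def c_def u mult_single)
    have "Poly_Mapping.keys (u + s) \<subseteq> {1..n}"
      using keys_lead_monom[of f n] f Ic unfolding u by blast
    then have "Poly_Mapping.keys u \<subseteq> {1..n}" by (auto simp: in_keys_iff lookup_add subset_iff)
    then show "q \<in> genideal (mpoly_ring n) (lead_terms ?S)"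
      using LS.I_l_closed[OF subsetD[OF genideal_self[OF ltS] s] single_closed[of u n c]]
      unfolding q_eq by simp
  qed
  then have "genideal (mpoly_ring n) (lead_terms ?I) \<subseteq> genideal (mpoly_ring n) (lead_terms ?S)"
    by (intro genideal_minimal LS.is_ideal)
  moreover have "lead_terms ?S \<subseteq> genideal (mpoly_ring n) (lead_terms ?I)"
    using SI genideal_self[OF ltI] by (auto simp: lead_terms_def)
  then have "genideal (mpoly_ring n) (lead_terms ?S) \<subseteq> genideal (mpoly_ring n) (lead_terms ?I)"
    by (intro genideal_minimal genideal_ideal[OF ltI])
  ultimately show ?thesis
    using SI finite_S_set by (auto simp: lex_groebner_basis_def)
qed

end
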